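(* Fix $k\in\mathbb Z_{\ge0}$. Let $(P,Q,R)$ be a $k$-GC triple whose $(1,2)$-entries $(a,b,c)=(p_{12},q_{12},r_{12})$ satisfy $b>\max\{a,c\}$. Then $(P,Q,R)$ has an MM decomposition, and it is unique up to sign: if $(X_1,Y_1,Z_1)$ and $(X_2,Y_2,Z_2)$ are MM decompositions of $(P,Q,R)$, then $(X_1,Y_1,Z_1)=\pm(X_2,Y_2,Z_2)$.
   Context: Fix $k\in\mathbb Z_{\ge0}$. A $k$-GM triple is $(a,b,c)\in\mathbb Z_{\ge1}^3$ with $a^2+b^2+c^2+k(bc+ca+ab)=(3+3k)abc$; a $k$-GM number is an entry of some $k$-GM triple. Let $S=\begin{bmatrix}k&0\\3k^2+3k&k\end{bmatrix}$. A $k$-GC matrix is $P\in SL(2,\mathbb Z)$ whose $(1,2)$-entry $p_{12}$ is a $k$-GM number and $\operatorname{tr}P=(3k+3)p_{12}-k$; a $k$-GC triple is a triple $(P,Q,R)$ of $k$-GC matrices with $Q=PR-S$ and $(p_{12},q_{12},r_{12})$ a $k$-GM triple. An MM decomposition of a $k$-GC triple $(P,Q,R)$ is a triple $(X,Y,Z)$ with $X,Y,Z\in SL(2,\mathbb Z)$, $P=-Z^{-1}Y^{-1}$, $Q=-Z^{-1}X^{-1}$, $R=-Y^{-1}X^{-1}$, and $\operatorname{tr}X=\operatorname{tr}Y=\operatorname{tr}Z$. *)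

theory Defs
  imports "HOL-Analysis.Analysis"
begin

definition GM_triple :: "int \<Rightarrow> int \<Rightarrow> int \<Rightarrow> int \<Rightarrow> bool" where
  "GM_triple k a b c \<longleftrightarrow> a \<ge> 1 \<and> b \<ge> 1 \<and> c \<ge> 1 \<and>
     a\<^sup>2 + b\<^sup>2 + c\<^sup>2 + k * (b * c + c * a + a * b) = (3 + 3 * k) * a * b * c"

definition GM_number :: "int \<Rightarrow> int \<Rightarrow> bool" where
  "GM_number k n \<longleftrightarrow> (\<exists>a b c. GM_triple k a b c \<and> n \<in> {a, b, c})"

definition SL2Z :: "(int^2^2) set" where
  "SL2Z = {A. det A = 1}"

definition S_mat :: "int \<Rightarrow> int^2^2" where
  "S_mat k = vector [vector [k, 0], vector [3 * k\<^sup>2 + 3 * k, k]]"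

definition GC_matrix :: "int \<Rightarrow> int^2^2 \<Rightarrow> bool" where
  "GC_matrix k P \<longleftrightarrow> P \<in> SL2Z \<and> GM_number k (P $ 1 $ 2) \<and>
     trace P = (3 * k + 3) * (P $ 1 $ 2) - k"

definition GC_triple :: "int \<Rightarrow> int^2^2 \<Rightarrow> int^2^2 \<Rightarrow> int^2^2 \<Rightarrow> bool" where
  "GC_triple k P Q R \<longleftrightarrow> GC_matrix k P \<and> GC_matrix k Q \<and> GC_matrix k R \<and>
     Q = P ** R - S_mat k \<and> GM_triple k (P $ 1 $ 2) (Q $ 1 $ 2) (R $ 1 $ 2)"

(* For a matrix in SL2Z, matrix_inv over int is the genuine two-sided integral inverse. *)
definition MM_decomposition ::
  "int^2^2 \<Rightarrow> int^2^2 \<Rightarrow> int^2^2 \<Rightarrow> int^2^2 \<Rightarrow> int^2^2 \<Rightarrow> int^2^2 \<Rightarrow> bool" where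
  "MM_decomposition P Q R X Y Z \<longleftrightarrow> X \<in> SL2Z \<and> Y \<in> SL2Z \<and> Z \<in> SL2Z \<and>
     P = - (matrix_inv Z ** matrix_inv Y) \<and>
     Q = - (matrix_inv Z ** matrix_inv X) \<and>
     R = - (matrix_inv Y ** matrix_inv X) \<and>
     trace X = trace Y \<and> trace Y = trace Z"

end

theory Submission
  imports Defs
begin

text \<open>
  Write \<open>S = k T\<close> with \<open>T\<close> unimodular. The trace conditions on \<open>P\<close>, \<open>Q\<close>, \<open>R\<close> say that
  \<open>P T\<^sup>-\<^sup>1\<close>, \<open>Q T\<^sup>-\<^sup>1\<close>, \<open>R T\<^sup>-\<^sup>1\<close> have trace \<open>-k\<close>, so Cayley--Hamilton shows that
  \<open>X = - T\<^sup>-\<^sup>1 P\<close>, \<open>Y = P\<^sup>-\<^sup>1 T R\<^sup>-\<^sup>1\<close>, \<open>Z = - R T\<^sup>-\<^sup>1\<close> is a decomposition, all traces being \<open>k\<close>.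

  For uniqueness, \<open>X\<close> and \<open>Z\<close> are determined by \<open>Y\<close>, and every decomposition satisfies
  \<open>P R - Q = (tr Y) P Y R\<close>. If \<open>Q \<noteq> P R\<close>, taking determinants determines \<open>Y\<close> up to sign. If
  \<open>Q = P R\<close>, then \<open>Y\<close>, \<open>P Y\<close> and \<open>Y R\<close> have trace zero, so that conjugation by \<open>Y\<close> inverts both
  \<open>P\<close> and \<open>R\<close>. Hence two candidates for \<open>Y\<close> differ by an element of the common centraliser of
  \<open>P\<close> and \<open>R\<close>. By Fricke's identity the Markov equation (\<open>k = 0\<close>) says that the commutator of
  \<open>P\<close> and \<open>R\<close> has trace \<open>-2\<close>; so \<open>P\<close> and \<open>R\<close> do not commute, and that centraliser is scalar.
\<close>

lemma matrix_mult_uminus_left [simp]: "(- A) ** B = - (A ** B)"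
  for A :: "'a::ring_1^'n^'m" and B :: "'a^'p^'n"
  by (simp add: vec_eq_iff matrix_matrix_mult_def sum_negf)

lemma matrix_mult_uminus_right [simp]: "A ** (- B) = - (A ** B)"
  for A :: "'a::ring_1^'n^'m" and B :: "'a^'p^'n"
  by (simp add: vec_eq_iff matrix_matrix_mult_def sum_negf)

lemma matrix_add_rdistrib: "(A + B) ** C = A ** C + B ** C"
  for A B :: "'a::semiring_1^'n^'m" and C :: "'a^'p^'n"
  by (simp add: vec_eq_iff matrix_matrix_mult_def distrib_right sum.distrib)

lemma trace_uminus [simp]: "trace (- A) = - trace A"
  for A :: "'a::ring_1^'n^'n"
  by (simp add: trace_def sum_negf)

lemma matrix_inv_unique:
  fixes A :: "'a::semiring_1^'n^'m"
  assumes "A ** B = mat 1" "B ** A = mat 1"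
  shows "matrix_inv A = B"
proof -
  have "A ** matrix_inv A = mat 1 \<and> matrix_inv A ** A = mat 1"
    unfolding matrix_inv_def by (rule someI[of _ B]) (simp add: assms)
  then show ?thesis
    by (metis assms(2) matrix_mul_assoc matrix_mul_lid matrix_mul_rid)
qed

definition adjugate2 :: "'a::comm_ring_1^2^2 \<Rightarrow> 'a^2^2" where
  "adjugate2 A = vector [vector [A $ 2 $ 2, - (A $ 1 $ 2)], vector [- (A $ 2 $ 1), A $ 1 $ 1]]"

lemmas mat2_simps = vec_eq_iff forall_2 sum_2 det_2 trace_def mat_def matrix_matrix_mult_def
  adjugate2_def

lemma adjugate2_adjugate2 [simp]: "adjugate2 (adjugate2 A) = A"
  by (simp add: mat2_simps)

lemma adjugate2_uminus [simp]: "adjugate2 (- A) = - adjugate2 A"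
  by (simp add: mat2_simps)

lemma adjugate2_mult: "adjugate2 (A ** B) = adjugate2 B ** adjugate2 A"
  by (simp add: mat2_simps algebra_simps)

lemma det_adjugate2 [simp]: "det (adjugate2 A) = det A"
  by (simp add: mat2_simps algebra_simps)

lemma trace_adjugate2 [simp]: "trace (adjugate2 A) = trace A"
  by (simp add: mat2_simps add.commute)

lemma det_uminus2 [simp]: "det (- A) = det A" for A :: "'a::comm_ring_1^2^2"
  by (simp add: mat2_simps)

lemma det_mat2 [simp]: "det (mat t :: 'a::comm_ring_1^2^2) = t\<^sup>2"
  by (simp add: mat2_simps power2_eq_square)

lemma adjugate2_eq_trace_diff: "adjugate2 A = mat (trace A) - A"
  by (simp add: mat2_simps)

lemma cayley_hamilton2: "A ** A + mat (det A) = mat (trace A) ** A"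
  for A :: "'a::comm_ring_1^2^2"
  by (simp add: mat2_simps algebra_simps)

lemma fricke_trace_commutator:
  fixes A B :: "'a::comm_ring_1^2^2"
  shows "trace (A ** B ** adjugate2 A ** adjugate2 B) =
    (trace A)\<^sup>2 * det B + (trace B)\<^sup>2 * det A + (trace (A ** B))\<^sup>2
      - trace A * trace B * trace (A ** B) - 2 * (det A * det B)"
  by (simp add: mat2_simps algebra_simps power2_eq_square)

lemma mult_adjugate2:
  shows "A ** adjugate2 A = mat (det A)" "adjugate2 A ** A = mat (det A)"
  by (simp_all add: mat2_simps algebra_simps)

lemma mult_adjugate2_cancel:
  assumes "det A = 1"
  shows "A ** (adjugate2 A ** B) = B" "adjugate2 A ** (A ** B) = B"
    "C ** A ** adjugate2 A = C" "C ** adjugate2 A ** A = C"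
  by (simp_all add: matrix_mul_assoc mult_adjugate2 assms)
    (simp_all add: matrix_mul_assoc[symmetric] mult_adjugate2 assms)

lemma matrix_inv_eq_adjugate2: "det A = 1 \<Longrightarrow> matrix_inv A = adjugate2 A"
  by (simp add: matrix_inv_unique mult_adjugate2)

lemma mult_eq_mult_adjugate2_if_trace_zero:
  assumes "trace B = 0" "trace (A ** B) = 0"
  shows "A ** B = B ** adjugate2 A"
proof -
  have "A ** B = - adjugate2 (A ** B)"
    by (simp add: adjugate2_eq_trace_diff assms(2))
  also have "\<dots> = - adjugate2 B ** adjugate2 A"
    by (simp add: adjugate2_mult)
  also have "- adjugate2 B = B"
    by (simp add: adjugate2_eq_trace_diff assms(1))
  finally show ?thesis .
qed

text \<open>
  Two matrices commute iff the vectors formed by their three traceless coordinates have vanishing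
  cross product. So two matrices commuting with a non-scalar one commute with each other.
\<close>

lemma scalar_if_commutes_with_noncommuting:
  fixes A B C :: "'a::idom^2^2"
  assumes "A ** C = C ** A" "B ** C = C ** B" "A ** B \<noteq> B ** A"
  shows "C = mat (C $ 1 $ 1)"
proof -
  define \<delta> where "\<delta> M = M $ 1 $ 1 - M $ 2 $ 2" for M :: "'a^2^2"
  have commute_iff: "M ** N = N ** M \<longleftrightarrow> M $ 1 $ 2 * N $ 2 $ 1 = N $ 1 $ 2 * M $ 2 $ 1 \<and>
      \<delta> M * N $ 1 $ 2 = \<delta> N * M $ 1 $ 2 \<and> \<delta> M * N $ 2 $ 1 = \<delta> N * M $ 2 $ 1"
    for M N :: "'a^2^2"
    unfolding \<delta>_def by (simp add: mat2_simps) algebra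
  have "C $ 1 $ 2 = 0 \<and> C $ 2 $ 1 = 0 \<and> \<delta> C = 0"
    using assms unfolding commute_iff by algebra
  then show ?thesis
    by (simp add: mat2_simps \<delta>_def)
qed

lemma proportional_eq_up_to_sign:
  fixes A B :: "'a::idom^2^2"
  assumes "mat s ** A = mat t ** B" "s \<noteq> 0" "det A = 1" "det B = 1"
  shows "A = B \<or> A = - B"
proof -
  have scaled: "s * A $ i $ j = t * B $ i $ j" for i j
    using assms(1) exhaust_2[of i] exhaust_2[of j] by (auto simp: mat2_simps)
  have "det (mat s ** A) = det (mat t ** B)"
    by (simp only: assms(1))
  then have "s\<^sup>2 = t\<^sup>2"
    by (simp add: det_mul assms(3,4))
  then have "t = s \<or> t = - s"
    by (auto simp: power2_eq_iff)
  then show ?thesis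
  proof
    assume "t = s"
    with scaled \<open>s \<noteq> 0\<close> show ?thesis
      by (simp add: vec_eq_iff)
  next
    assume "t = - s"
    then have "s * A $ i $ j = s * (- B $ i $ j)" for i j
      using scaled[of i j] by simp
    then have "A $ i $ j = - B $ i $ j" for i j
      using \<open>s \<noteq> 0\<close> mult_left_cancel by blast
    then have "A = - B"
      by (simp add: vec_eq_iff)
    then show ?thesis ..
  qed
qed

lemma inverting_conjugation_unique:
  fixes A B Y Y' :: "'a::idom^2^2"
  assumes noncommuting: "A ** B \<noteq> B ** A"
    and det: "det Y = 1" "det Y' = 1"
    and Y: "A ** Y = Y ** adjugate2 A" "B ** Y = Y ** adjugate2 B"
    and Y': "A ** Y' = Y' ** adjugate2 A" "B ** Y' = Y' ** adjugate2 B"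
  shows "Y = Y' \<or> Y = - Y'"
proof -
  define C where "C = Y ** adjugate2 Y'"
  have commute: "M ** C = C ** M"
    if "M ** Y = Y ** adjugate2 M" "M ** Y' = Y' ** adjugate2 M" for M
  proof -
    have "M ** C = Y ** (adjugate2 M ** adjugate2 Y')"
      by (simp add: C_def matrix_mul_assoc that(1))
    also have "adjugate2 M ** adjugate2 Y' = adjugate2 Y' ** M"
    proof -
      have "adjugate2 M = adjugate2 Y' ** M ** Y'"
        by (simp add: matrix_mul_assoc[symmetric] that(2) mult_adjugate2_cancel det(2))
      then show ?thesis
        by (simp add: mult_adjugate2_cancel det(2))
    qed
    also have "Y ** (adjugate2 Y' ** M) = C ** M"
      by (simp add: C_def matrix_mul_assoc)
    finally show ?thesis .
  qed
  obtain t where "C = mat t"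
    using scalar_if_commutes_with_noncommuting[OF _ _ noncommuting] commute Y Y' by blast
  then have "mat 1 ** Y = mat t ** Y'"
    using mult_adjugate2_cancel(4)[OF det(2), of Y] by (simp add: C_def)
  then show ?thesis
    using proportional_eq_up_to_sign det zero_neq_one by metis
qed

lemma MM_decomposition_iff:
  "MM_decomposition P Q R X Y Z \<longleftrightarrow> det X = 1 \<and> det Y = 1 \<and> det Z = 1 \<and>
     P = - (adjugate2 Z ** adjugate2 Y) \<and> Q = - (adjugate2 Z ** adjugate2 X) \<and>
     R = - (adjugate2 Y ** adjugate2 X) \<and> trace X = trace Y \<and> trace Y = trace Z"
  unfolding MM_decomposition_def SL2Z_def by (auto simp: matrix_inv_eq_adjugate2)

lemma MM_decomposition_exists:
  assumes det: "det P = 1" "det R = 1" "det T = 1"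
    and Q: "Q = P ** R - mat k ** T"
    and traces: "trace (P ** adjugate2 T) = - k" "trace (Q ** adjugate2 T) = - k"
      "trace (R ** adjugate2 T) = - k"
  shows "MM_decomposition P Q R (- (adjugate2 T ** P)) (adjugate2 P ** T ** adjugate2 R)
    (- (R ** adjugate2 T))"
proof -
  define W where "W = P ** R ** adjugate2 T"
  have "(Q + mat k ** T) ** adjugate2 T = Q ** adjugate2 T + mat k"
    using mult_adjugate2_cancel(3)[OF det(3)] by (simp add: matrix_add_rdistrib)
  then have W: "W = Q ** adjugate2 T + mat k"
    by (simp add: W_def Q)
  then have trace_W: "trace W = k"
    by (simp add: trace_add traces(2)) (simp add: mat2_simps)
  have "Q ** adjugate2 T = W - mat (trace W)"
    by (simp add: trace_W) (simp add: W)
  also have "\<dots> = - adjugate2 W"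
    by (simp add: adjugate2_eq_trace_diff)
  finally have "Q ** adjugate2 T = - adjugate2 W" .
  then have "Q ** adjugate2 T ** T = - (T ** adjugate2 (P ** R) ** T)"
    by (simp add: W_def adjugate2_mult)
  then have Q_eq: "Q = - (T ** adjugate2 R ** adjugate2 P ** T)"
    by (simp add: mult_adjugate2_cancel det adjugate2_mult matrix_mul_assoc)
  have "trace (adjugate2 P ** T ** adjugate2 R) = trace (R ** adjugate2 T ** P)"
    using trace_adjugate2[of "adjugate2 P ** T ** adjugate2 R"]
    by (simp add: adjugate2_mult matrix_mul_assoc)
  also have "\<dots> = k"
    using trace_W unfolding W_def by (metis trace_mul_sym matrix_mul_assoc)
  finally have "trace (adjugate2 P ** T ** adjugate2 R) = k" .
  moreover have "trace (- (adjugate2 T ** P)) = k" "trace (- (R ** adjugate2 T)) = k"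
    by (simp_all add: traces(1,3) trace_mul_sym[of "adjugate2 T"])
  ultimately show ?thesis
    unfolding MM_decomposition_iff using Q_eq
    by (simp add: det det_mul adjugate2_mult matrix_mul_assoc mult_adjugate2_cancel mult_adjugate2)
qed

lemma MM_decomposition_outer_eq:
  assumes "MM_decomposition P Q R X Y Z"
  shows "X = - (adjugate2 R ** adjugate2 Y)" "Z = - (adjugate2 Y ** adjugate2 P)"
  using assms unfolding MM_decomposition_iff
  by (auto simp: adjugate2_mult mult_adjugate2_cancel)

lemma MM_decomposition_det:
  assumes "MM_decomposition P Q R X Y Z"
  shows "det P = 1" "det Y = 1" "det R = 1"
  using assms unfolding MM_decomposition_iff by (auto simp: det_mul)

lemma MM_decomposition_trace_mult_middle:
  assumes "MM_decomposition P Q R X Y Z"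
  shows "trace (P ** Y) = - trace Y" "trace (R ** Y) = - trace Y"
proof -
  have "P ** Y = - adjugate2 Z" "Y ** R = - adjugate2 X" "trace X = trace Y" "trace Z = trace Y"
    using assms unfolding MM_decomposition_iff by (auto simp: mult_adjugate2_cancel)
  then show "trace (P ** Y) = - trace Y" "trace (R ** Y) = - trace Y"
    by (simp_all add: trace_mul_sym[of R])
qed

lemma MM_decomposition_mult_diff:
  assumes "MM_decomposition P Q R X Y Z"
  shows "P ** R - Q = mat (trace Y) ** (P ** Y ** R)"
proof -
  have Y: "det Y = 1"
    and P: "P = - (adjugate2 Z ** adjugate2 Y)" and Q: "Q = - (adjugate2 Z ** adjugate2 X)"
    and R: "R = - (adjugate2 Y ** adjugate2 X)"
    using assms unfolding MM_decomposition_iff by auto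
  have "P ** R - Q = adjugate2 Z ** (adjugate2 Y ** adjugate2 Y + mat 1) ** adjugate2 X"
    by (simp add: P Q R matrix_mul_assoc matrix_add_ldistrib matrix_add_rdistrib)
  also have "adjugate2 Y ** adjugate2 Y + mat 1 = mat (trace Y) ** adjugate2 Y"
    using cayley_hamilton2[of "adjugate2 Y"] by (simp add: Y)
  also have "adjugate2 Z ** (mat (trace Y) ** adjugate2 Y) ** adjugate2 X =
      mat (trace Y) ** (adjugate2 Z ** adjugate2 Y ** adjugate2 X)"
    by (simp add: mat2_simps algebra_simps)
  also have "adjugate2 Z ** adjugate2 Y ** adjugate2 X = P ** Y ** R"
    by (simp add: P R matrix_mul_assoc mult_adjugate2_cancel Y)
  finally show ?thesis .
qed

lemma MM_decomposition_trace_eq_0_iff: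
  assumes "MM_decomposition P Q R X Y Z"
  shows "trace Y = 0 \<longleftrightarrow> Q = P ** R"
proof -
  have "(trace Y)\<^sup>2 = det (P ** R - Q)"
    by (simp add: MM_decomposition_mult_diff[OF assms] det_mul MM_decomposition_det[OF assms])
  moreover have "trace Y = 0 \<Longrightarrow> P ** R - Q = 0"
    using MM_decomposition_mult_diff[OF assms] by (simp add: mat2_simps)
  ultimately show ?thesis
    by (auto simp: det_2)
qed

lemma MM_decomposition_middle_unique:
  assumes MM: "MM_decomposition P Q R X Y Z" "MM_decomposition P Q R X' Y' Z'"
    and noncommuting: "Q = P ** R \<Longrightarrow> P ** R \<noteq> R ** P"
  shows "Y = Y' \<or> Y = - Y'"
proof (cases "Q = P ** R")
  case True
  then have "trace Y = 0" "trace Y' = 0"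
    using MM MM_decomposition_trace_eq_0_iff by blast+
  then have "M ** Y = Y ** adjugate2 M" "M ** Y' = Y' ** adjugate2 M" if "M \<in> {P, R}" for M
    using that MM[THEN MM_decomposition_trace_mult_middle(1)]
      MM[THEN MM_decomposition_trace_mult_middle(2)]
    by (auto intro: mult_eq_mult_adjugate2_if_trace_zero)
  then show ?thesis
    using inverting_conjugation_unique[OF noncommuting[OF True]] MM[THEN MM_decomposition_det(2)]
    by simp
next
  case False
  note det = MM[THEN MM_decomposition_det(1)] MM[THEN MM_decomposition_det(2)]
    MM[THEN MM_decomposition_det(3)]
  have "mat (trace Y) ** (P ** Y ** R) = mat (trace Y') ** (P ** Y' ** R)"
    using MM[THEN MM_decomposition_mult_diff] by simp
  moreover have "trace Y \<noteq> 0"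
    using MM_decomposition_trace_eq_0_iff[OF MM(1)] False by simp
  ultimately have "P ** Y ** R = P ** Y' ** R \<or> P ** Y ** R = - (P ** Y' ** R)"
    by (rule proportional_eq_up_to_sign) (simp_all add: det_mul det)
  moreover have "adjugate2 P ** (P ** M ** R) ** adjugate2 R = M" for M
    by (simp add: matrix_mul_assoc mult_adjugate2 mult_adjugate2_cancel det)
  ultimately show ?thesis
    by (metis matrix_mult_uminus_left matrix_mult_uminus_right)
qed

lemma MM_decomposition_unique:
  assumes MM: "MM_decomposition P Q R X Y Z" "MM_decomposition P Q R X' Y' Z'"
    and "Q = P ** R \<Longrightarrow> P ** R \<noteq> R ** P"
  shows "(X, Y, Z) = (X', Y', Z') \<or> (X, Y, Z) = (- X', - Y', - Z')"
  using MM_decomposition_middle_unique[OF assms] MM[THEN MM_decomposition_outer_eq(1)]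
    MM[THEN MM_decomposition_outer_eq(2)]
  by auto

definition lower_shear :: "'a::comm_ring_1 \<Rightarrow> 'a^2^2" where
  "lower_shear t = vector [vector [1, 0], vector [t, 1]]"

lemma det_lower_shear [simp]: "det (lower_shear t) = 1"
  by (simp add: lower_shear_def det_2)

lemma trace_mult_adjugate2_lower_shear:
  "trace (A ** adjugate2 (lower_shear t)) = trace A - t * A $ 1 $ 2"
  by (simp add: lower_shear_def mat2_simps algebra_simps)

lemma S_mat_eq_mat_mult_lower_shear: "S_mat k = mat k ** lower_shear (3 * k + 3)"
  by (simp add: S_mat_def lower_shear_def mat2_simps algebra_simps power2_eq_square)

lemma GC_matrixD:
  assumes "GC_matrix k P"
  shows "det P = 1" "trace P = (3 * k + 3) * P $ 1 $ 2 - k"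
  using assms by (simp_all add: GC_matrix_def SL2Z_def)

lemma GC_tripleD:
  assumes "GC_triple k P Q R"
  shows "GC_matrix k P" "GC_matrix k Q" "GC_matrix k R" "Q = P ** R - S_mat k"
    "GM_triple k (P $ 1 $ 2) (Q $ 1 $ 2) (R $ 1 $ 2)"
  using assms unfolding GC_triple_def by blast+

lemma GC_triple_MM_decomposition_exists:
  assumes "GC_triple k P Q R"
  shows "\<exists>X Y Z. MM_decomposition P Q R X Y Z"
proof -
  note GC = GC_tripleD[OF assms]
  let ?T = "lower_shear (3 * k + 3)"
  have "trace (A ** adjugate2 ?T) = - k" if "GC_matrix k A" for A
    by (simp add: trace_mult_adjugate2_lower_shear GC_matrixD(2)[OF that])
  with GC show ?thesis
    using MM_decomposition_exists[of P R ?T Q k] GC_matrixD(1) det_lower_shear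
      S_mat_eq_mat_mult_lower_shear by metis
qed

lemma GC_triple_not_commute:
  assumes GC_triple: "GC_triple k P Q R" and product: "Q = P ** R"
  shows "P ** R \<noteq> R ** P"
proof
  assume commute: "P ** R = R ** P"
  note GC = GC_tripleD[OF GC_triple]
  note det = GC(1,3)[THEN GC_matrixD(1)]
  have "S_mat k = 0"
    using GC(4) product by simp
  then have k: "k = 0"
    by (simp add: S_mat_def vec_eq_iff forall_2)
  have traces: "trace P = 3 * P $ 1 $ 2" "trace Q = 3 * Q $ 1 $ 2" "trace R = 3 * R $ 1 $ 2"
    using GC(1-3)[THEN GC_matrixD(2)] by (simp_all add: k)
  have "(2::int) = trace (P ** R ** adjugate2 P ** adjugate2 R)"
    by (simp add: commute mult_adjugate2_cancel mult_adjugate2 det trace_I)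
  also have "\<dots> = (trace P)\<^sup>2 + (trace R)\<^sup>2 + (trace Q)\<^sup>2 - trace P * trace R * trace Q - 2"
    by (simp add: fricke_trace_commutator det product)
  also have "\<dots> = - 2"
    using GC(5) unfolding k traces GM_triple_def by algebra
  finally show False
    by simp
qed

theorem theorem5p22:
  fixes k :: int and P Q R :: "int^2^2"
  assumes "k \<ge> 0"
    and "GC_triple k P Q R"
    and "Q $ 1 $ 2 > max (P $ 1 $ 2) (R $ 1 $ 2)"
  shows "(\<exists>X Y Z. MM_decomposition P Q R X Y Z) \<and>
    (\<forall>X\<^sub>1 Y\<^sub>1 Z\<^sub>1 X\<^sub>2 Y\<^sub>2 Z\<^sub>2.
       MM_decomposition P Q R X\<^sub>1 Y\<^sub>1 Z\<^sub>1 \<longrightarrow> MM_decomposition P Q R X\<^sub>2 Y\<^sub>2 Z\<^sub>2 \<longrightarrow>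
       (X\<^sub>1, Y\<^sub>1, Z\<^sub>1) = (X\<^sub>2, Y\<^sub>2, Z\<^sub>2) \<or> (X\<^sub>1, Y\<^sub>1, Z\<^sub>1) = (- X\<^sub>2, - Y\<^sub>2, - Z\<^sub>2))"
proof (intro conjI allI impI)
  show "\<exists>X Y Z. MM_decomposition P Q R X Y Z"
    by (rule GC_triple_MM_decomposition_exists[OF assms(2)])
next
  fix X\<^sub>1 Y\<^sub>1 Z\<^sub>1 X\<^sub>2 Y\<^sub>2 Z\<^sub>2
  assume "MM_decomposition P Q R X\<^sub>1 Y\<^sub>1 Z\<^sub>1" "MM_decomposition P Q R X\<^sub>2 Y\<^sub>2 Z\<^sub>2"
  then show "(X\<^sub>1, Y\<^sub>1, Z\<^sub>1) = (X\<^sub>2, Y\<^sub>2, Z\<^sub>2) \<or> (X\<^sub>1, Y\<^sub>1, Z\<^sub>1) = (- X\<^sub>2, - Y\<^sub>2, - Z\<^sub>2)"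
    using GC_triple_not_commute[OF assms(2)] by (rule MM_decomposition_unique)
qed

end
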